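(* The HMDGFE Algorithm is locally and globally conservative. That is, let $(\mathbf u_h^n,p_h^n,\lambda_h^n)$, $(\boldsymbol\sigma_h^n,c_h^n,\lambda_h^{c,n})$, $n=1,\dots,M$, be a solution of the algorithm. Then: (1) (local conservation, flow) for every $K\in\mathcal T_h$, $\int_{\partial K}\mathbf u_h^n\cdot\mathbf n\,ds=\int_Kq^n\,dx$; (2) (global conservation, flow) for every interior face $e=\partial K_1\cap\partial K_2$ the normal flux is continuous across $e$: $\mathbf u_h^n|_{K_1}\cdot\mathbf n_{K_1}+\mathbf u_h^n|_{K_2}\cdot\mathbf n_{K_2}=0$ on $e$; (3) (local conservation, concentration) for every $K\in\mathcal T_h$, $\frac1{\Delta t}\int_K\phi\,(c_h^n-c_h^{n-1})\,dx+\int_{\partial K}\boldsymbol\sigma_h^n\cdot\mathbf n\,ds+\int_{\partial K^{out}}\mathbf u_h^n\cdot\mathbf n\,c_h^n\,ds+\int_{\partial K^{in}}\mathbf u_h^n\cdot\mathbf n\,\lambda_h^{c,n}\,ds=\int_Kq^nc_h^{*,n}\,dx$; (4) (global conservation, concentration) for every interior face $e=\partial K_1\cap\partial K_2$, the total outflow through $e$ from one element balances the inflow through $e$ into the neighbouring one: $\sum_{i=1}^2\int_e\left(\boldsymbol\sigma_h^n|_{K_i}\cdot\mathbf n_{K_i}+\mathbf u_h^n|_{K_i}\cdot\mathbf n_{K_i}\,\hat c_h^n|_{\partial K_i}\right)ds=0$.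
   Context: Data. $\Omega\subset\mathbb R^d$ ($d=2,3$) is a bounded polygonal/polyhedral domain; $k^*(x)$, $\phi(x)$, $\mu(c)$ are permeability, porosity, viscosity, $q(x,t)$ is a source, $c^*$ an external concentration prescribed where $q>0$ and equal to the concentration where $q<0$. $D(\mathbf u)=\phi[d_mI+|\mathbf u|(d_lE(\mathbf u)+d_tE^\perp(\mathbf u))]$ with $E(\mathbf u)=(u_iu_j/|\mathbf u|^2)_{d\times d}$, $E^\perp=I-E$, constants $d_m>0$, $d_l,d_t\ge0$. Put $a(c)=\mu(c)/k^*$. The algorithm approximates the problem $\nabla\cdot\mathbf u=q$, $\mathbf u=-\frac{k^*}{\mu(c)}\nabla p$, $\phi\,\partial_tc+\nabla\cdot(\mathbf uc-D(\mathbf u)\nabla c)=qc^*$ in $\Omega\times(0,T]$, $\mathbf u\cdot\mathbf n=0$, $D(\mathbf u)\nabla c\cdot\mathbf n=0$ on $\partial\Omega$, $c(x,0)=c_0(x)$. Mesh and spaces. $\mathcal T_h$ is a quasi-uniform regular partition of $\Omega$ into elements $K$; $\partial\mathcal T_h$ is the set of all element edges/faces $e$. $(u,v)_{\mathcal T_h}=\sum_K\int_Kuv\,dx$, $\langle u,v\rangle_{\partial\mathcal T_h}=\sum_K\int_{\partial K}uv\,ds$ ($\mathbf n=\mathbf n_K$ is the outward normal of $K$ on $\partial K$; derivatives are elementwise). $\Lambda_h=\{v\in L^2:v|_K\in P_k(K)\ \forall K\}$, $\Theta_h=\{v\in[L^2]^d:v|_K\in RT_k(K)\ \forall K\}$ with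 $RT_k(K)=[P_k(K)]^d\oplus xP_k(K)$ (no interelement continuity), $\Sigma_h=\{v\in L^2(\partial\mathcal T_h):v|_e\in P_k(e)\ \forall e\}$ (single valued on each $e$). Time: $\Delta t=T/M$, $t^n=n\Delta t$, $w^n=w(\cdot,t^n)$. Forms. For a velocity field $\mathbf w$, $\partial K^{out}=\{x\in\partial K:\mathbf w\cdot\mathbf n>0\}$, $\partial K^{in}=\partial K\setminus\partial K^{out}$ (with $\mathbf w=\mathbf u_h^n$ for the discrete quantities). Given $(c,\lambda^c)$, $\hat c=\lambda^c$ on $\partial K^{in}$ and $\hat c=c$ on $\partial K^{out}$; $\hat c_h^n$ is formed from $(c_h^n,\lambda_h^{c,n})$. Define $B_{\mathbf u}(\tilde c;(\mathbf u,p,\lambda),(\boldsymbol\tau,v,\mu))=(a(\tilde c)\mathbf u,\boldsymbol\tau)_{\mathcal T_h}+(\nabla p,\boldsymbol\tau)_{\mathcal T_h}+(\mathbf u,\nabla v)_{\mathcal T_h}+\langle\lambda-p,\boldsymbol\tau\cdot\mathbf n\rangle_{\partial\mathcal T_h}+\langle\mathbf u\cdot\mathbf n,\mu-v\rangle_{\partial\mathcal T_h}$, $B_c(\mathbf w;(\boldsymbol\sigma,c,\lambda^c),(\boldsymbol\tau,v,\mu))=-\frac1{\Delta t}(\phi c,v)_{\mathcal T_h}+(\boldsymbol\sigma+\mathbf wc,\nabla v)_{\mathcal T_h}+(D(\mathbf w)^{-1}\boldsymbol\sigma+\nabla c,\boldsymbol\tau)_{\mathcal T_h}+\langle\lambda^c-c,\boldsymbol\tau\cdot\mathbf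 n\rangle_{\partial\mathcal T_h}+\langle\boldsymbol\sigma\cdot\mathbf n+\mathbf w\cdot\mathbf n\,\hat c,\mu-v\rangle_{\partial\mathcal T_h}$. HMDGFE Algorithm. Given $c_h^0\in\Lambda_h$, for $n=1,\dots,M$ find $(\mathbf u_h^n,p_h^n,\lambda_h^n)$ and $(\boldsymbol\sigma_h^n,c_h^n,\lambda_h^{c,n})$ in $\Theta_h\times\Lambda_h\times\Sigma_h$ such that for all $(\boldsymbol\tau_h,v_h,\mu_h)\in\Theta_h\times\Lambda_h\times\Sigma_h$: $B_{\mathbf u}(c_h^{n-1};(\mathbf u_h^n,p_h^n,\lambda_h^n),(\boldsymbol\tau_h,v_h,\mu_h))=-(q^n,v_h)_{\mathcal T_h}$ and $B_c(\mathbf u_h^n;(\boldsymbol\sigma_h^n,c_h^n,\lambda_h^{c,n}),(\boldsymbol\tau_h,v_h,\mu_h))=-(q^nc_h^{*,n}+\frac{\phi}{\Delta t}c_h^{n-1},v_h)_{\mathcal T_h}$, where $c_h^{*,n}$ is the prescribed value $c^{*,n}$ where $q^n>0$ and equals $c_h^n$ where $q^n<0$. *)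

theory Defs
  imports "HOL-Analysis.Analysis"
begin

section \<open>Domain and mesh\<close>

definition polyhedral_domain :: "(real^'d) set \<Rightarrow> bool" where
  "polyhedral_domain \<Omega> \<longleftrightarrow>
     \<Omega> \<noteq> {} \<and> open \<Omega> \<and> connected \<Omega> \<and> bounded \<Omega> \<and>
     (\<exists>\<P>. finite \<P> \<and> (\<forall>P\<in>\<P>. polytope P) \<and> \<Omega> = interior (\<Union>\<P>))"

text \<open>Elements are closed convex polytopes (in particular simplices are allowed), and the
  partition is face-to-face.\<close>

definition partition_of_domain :: "(real^'d) set \<Rightarrow> (real^'d) set set \<Rightarrow> bool" where
  "partition_of_domain \<Omega> Th \<longleftrightarrow>
     finite Th \<and> \<Union>Th = closure \<Omega> \<and>
     (\<forall>K\<in>Th. polytope K \<and> interior K \<noteq> {}) \<and>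
     (\<forall>K1\<in>Th. \<forall>K2\<in>Th. K1 \<inter> K2 face_of K1 \<and> K1 \<inter> K2 face_of K2) \<and>
     (\<forall>K1\<in>Th. \<forall>K2\<in>Th. K1 \<noteq> K2 \<longrightarrow> interior K1 \<inter> interior K2 = {})"

definition inscribed_diameter :: "(real^'d) set \<Rightarrow> real" where
  "inscribed_diameter K = 2 * Sup {r. 0 \<le> r \<and> (\<exists>x. cball x r \<subseteq> K)}"

text \<open>Shape regularity and quasi-uniformity, with the constant \<open>\<kappa>\<close> that would be common to all
  members of a family of meshes.\<close>

definition quasi_uniform_regular :: "real \<Rightarrow> (real^'d) set set \<Rightarrow> bool" where
  "quasi_uniform_regular \<kappa> Th \<longleftrightarrow>
     (\<forall>K\<in>Th. diameter K \<le> \<kappa> * inscribed_diameter K) \<and>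
     (\<forall>K\<in>Th. \<forall>K'\<in>Th. diameter K \<le> \<kappa> * diameter K')"

definition mesh_faces :: "(real^'d) set set \<Rightarrow> (real^'d) set set" where
  "mesh_faces Th = {e. \<exists>K\<in>Th. e facet_of K}"

definition interior_face ::
  "(real^'d) set set \<Rightarrow> (real^'d) set \<Rightarrow> (real^'d) set \<Rightarrow> (real^'d) set \<Rightarrow> bool" where
  "interior_face Th e K1 K2 \<longleftrightarrow>
     K1 \<in> Th \<and> K2 \<in> Th \<and> K1 \<noteq> K2 \<and> e = frontier K1 \<inter> frontier K2 \<and>
     e facet_of K1 \<and> e facet_of K2"

definition outward_normal :: "(real^'d) set \<Rightarrow> (real^'d) set \<Rightarrow> real^'d" where
  "outward_normal K e =
     (THE n. norm n = 1 \<and> (\<exists>b. K \<subseteq> {x. n \<bullet> x \<le> b} \<and> e = K \<inter> {x. n \<bullet> x = b}))"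


section \<open>Integration over faces and elements\<close>

text \<open>The \<open>(d-1)\<close>-dimensional Lebesgue measure on the hyperplane \<open>H\<close> spanned by a face: by Fubini,
  the surface measure of \<open>A \<subseteq> H\<close> is the \<open>d\<close>-dimensional measure of the right prism of height 1
  with mid-section \<open>A\<close>, i.e. of the points at distance at most \<open>1/2\<close> from \<open>H\<close> whose orthogonal
  projection to \<open>H\<close> lies in \<open>A\<close>.\<close>

definition surface_measure :: "(real^'d) set \<Rightarrow> (real^'d) measure" where
  "surface_measure e =
     distr (restrict_space lborel {x. infdist x (affine hull e) \<le> 1/2}) borel
       (closest_point (affine hull e))"

text \<open>Discontinuous piecewise functions are represented by families: \<open>v K\<close> is the restriction of
  \<open>v\<close> to the closed element \<open>K\<close> (so it also gives the trace on \<open>\<partial>K\<close> seen from \<open>K\<close>), and \<open>m e\<close> is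
  the restriction of a skeleton function to the face \<open>e\<close>. The values of \<open>v K\<close> off \<open>K\<close> and
  of \<open>m e\<close> off \<open>e\<close> are irrelevant.\<close>

type_synonym 'd scal = "(real^'d) set \<Rightarrow> real^'d \<Rightarrow> real"
type_synonym 'd vec_field = "(real^'d) set \<Rightarrow> real^'d \<Rightarrow> real^'d"

definition elements_int :: "(real^'d) set set \<Rightarrow> ((real^'d) set \<Rightarrow> real^'d \<Rightarrow> real) \<Rightarrow> real" where
  "elements_int Th f = (\<Sum>K\<in>Th. LINT x:K|lebesgue. f K x)"

definition boundary_int :: "(real^'d) set \<Rightarrow> ((real^'d) set \<Rightarrow> real^'d \<Rightarrow> real) \<Rightarrow> real" where
  "boundary_int K f = (\<Sum>e | e facet_of K. LINT x:e|surface_measure e. f e x)"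

definition skeleton_int ::
  "(real^'d) set set \<Rightarrow> ((real^'d) set \<Rightarrow> (real^'d) set \<Rightarrow> real^'d \<Rightarrow> real) \<Rightarrow> real" where
  "skeleton_int Th f = (\<Sum>K\<in>Th. boundary_int K (f K))"

definition grad :: "(real^'d \<Rightarrow> real) \<Rightarrow> real^'d \<Rightarrow> real^'d" where
  "grad f x = (\<chi> i. frechet_derivative f (at x) (axis i 1))"


section \<open>Discrete spaces\<close>

definition polys :: "nat \<Rightarrow> (real^'d) set \<Rightarrow> (real^'d \<Rightarrow> real) set" where
  "polys k S =
     {f. \<exists>a. \<forall>x\<in>S. f x = (\<Sum>\<alpha> | (\<Sum>i\<in>UNIV. \<alpha> i) \<le> k. a \<alpha> * (\<Prod>i\<in>UNIV. (x $ i) ^ \<alpha> i))}"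

definition RT :: "nat \<Rightarrow> (real^'d) set \<Rightarrow> (real^'d \<Rightarrow> real^'d) set" where
  "RT k K =
     {f. \<exists>g s. (\<forall>i. (\<lambda>x. g x $ i) \<in> polys k K) \<and> s \<in> polys k K \<and>
               (\<forall>x\<in>K. f x = g x + s x *\<^sub>R x)}"

definition Lambda_h :: "nat \<Rightarrow> (real^'d) set set \<Rightarrow> 'd scal set" where
  "Lambda_h k Th = {v. \<forall>K\<in>Th. v K \<in> polys k K}"

definition Theta_h :: "nat \<Rightarrow> (real^'d) set set \<Rightarrow> 'd vec_field set" where
  "Theta_h k Th = {v. \<forall>K\<in>Th. v K \<in> RT k K}"

definition Sigma_h :: "nat \<Rightarrow> (real^'d) set set \<Rightarrow> 'd scal set" where
  "Sigma_h k Th = {m. \<forall>e\<in>mesh_faces Th. m e \<in> polys k e}"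


section \<open>Coefficients and forms\<close>

text \<open>For \<open>w = 0\<close> the quotient is \<open>0\<close> here, but it only occurs multiplied by \<open>|w|\<close>.\<close>

definition E_mat :: "real^'d \<Rightarrow> real^'d^'d" where
  "E_mat w = (\<chi> i j. w $ i * w $ j / (norm w)\<^sup>2)"

definition dispersion :: "real \<Rightarrow> real \<Rightarrow> real \<Rightarrow> real \<Rightarrow> real^'d \<Rightarrow> real^'d^'d" where
  "dispersion dm dl dt \<phi>x w =
     \<phi>x *\<^sub>R (dm *\<^sub>R mat 1 + norm w *\<^sub>R (dl *\<^sub>R E_mat w + dt *\<^sub>R (mat 1 - E_mat w)))"

definition outflow :: "'d vec_field \<Rightarrow> (real^'d) set \<Rightarrow> (real^'d) set \<Rightarrow> (real^'d) set" where
  "outflow w K e = {x \<in> e. w K x \<bullet> outward_normal K e > 0}"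

definition inflow :: "'d vec_field \<Rightarrow> (real^'d) set \<Rightarrow> (real^'d) set \<Rightarrow> (real^'d) set" where
  "inflow w K e = e - outflow w K e"

definition upwind ::
  "'d vec_field \<Rightarrow> 'd scal \<Rightarrow> 'd scal \<Rightarrow> (real^'d) set \<Rightarrow> (real^'d) set \<Rightarrow> real^'d \<Rightarrow> real" where
  "upwind w c l K e x = (if x \<in> outflow w K e then c K x else l e x)"

definition B_u ::
  "(real^'d) set set \<Rightarrow> (real^'d \<Rightarrow> real) \<Rightarrow> (real \<Rightarrow> real) \<Rightarrow> 'd scal
   \<Rightarrow> 'd vec_field \<times> 'd scal \<times> 'd scal \<Rightarrow> 'd vec_field \<times> 'd scal \<times> 'd scal \<Rightarrow> real" where
  "B_u Th perm visc ct = (\<lambda>(u, p, l) (\<tau>, v, m).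
      elements_int Th (\<lambda>K x. (visc (ct K x) / perm x) *\<^sub>R u K x \<bullet> \<tau> K x)
    + elements_int Th (\<lambda>K x. grad (p K) x \<bullet> \<tau> K x)
    + elements_int Th (\<lambda>K x. u K x \<bullet> grad (v K) x)
    + skeleton_int Th (\<lambda>K e x. (l e x - p K x) * (\<tau> K x \<bullet> outward_normal K e))
    + skeleton_int Th (\<lambda>K e x. (u K x \<bullet> outward_normal K e) * (m e x - v K x)))"

definition B_c ::
  "(real^'d) set set \<Rightarrow> (real^'d \<Rightarrow> real) \<Rightarrow> real \<Rightarrow> real \<Rightarrow> real \<Rightarrow> real \<Rightarrow> 'd vec_field
   \<Rightarrow> 'd vec_field \<times> 'd scal \<times> 'd scal \<Rightarrow> 'd vec_field \<times> 'd scal \<times> 'd scal \<Rightarrow> real" where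
  "B_c Th \<phi> dm dl dt \<Delta>t w = (\<lambda>(\<sigma>, c, l) (\<tau>, v, m).
    - (1 / \<Delta>t) * elements_int Th (\<lambda>K x. \<phi> x * c K x * v K x)
    + elements_int Th (\<lambda>K x. (\<sigma> K x + c K x *\<^sub>R w K x) \<bullet> grad (v K) x)
    + elements_int Th (\<lambda>K x.
        (matrix_inv (dispersion dm dl dt (\<phi> x) (w K x)) *v \<sigma> K x + grad (c K) x) \<bullet> \<tau> K x)
    + skeleton_int Th (\<lambda>K e x. (l e x - c K x) * (\<tau> K x \<bullet> outward_normal K e))
    + skeleton_int Th (\<lambda>K e x.
        (\<sigma> K x \<bullet> outward_normal K e + (w K x \<bullet> outward_normal K e) * upwind w c l K e x)
          * (m e x - v K x)))"


section \<open>The HMDGFE algorithm\<close>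

text \<open>Where \<open>q = 0\<close> the value is irrelevant, as it only enters through the product with \<open>q\<close>.\<close>

definition ext_conc :: "(real^'d \<Rightarrow> real) \<Rightarrow> (real^'d \<Rightarrow> real) \<Rightarrow> 'd scal \<Rightarrow> 'd scal" where
  "ext_conc qn cstar_n c K x = (if qn x > 0 then cstar_n x else c K x)"

definition HMDGFE_solution ::
  "nat \<Rightarrow> (real^'d) set set \<Rightarrow> (real^'d \<Rightarrow> real) \<Rightarrow> (real^'d \<Rightarrow> real) \<Rightarrow> (real \<Rightarrow> real)
   \<Rightarrow> real \<Rightarrow> real \<Rightarrow> real \<Rightarrow> (real^'d \<Rightarrow> real \<Rightarrow> real) \<Rightarrow> (real^'d \<Rightarrow> real \<Rightarrow> real)
   \<Rightarrow> real \<Rightarrow> nat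
   \<Rightarrow> (nat \<Rightarrow> 'd vec_field) \<Rightarrow> (nat \<Rightarrow> 'd scal) \<Rightarrow> (nat \<Rightarrow> 'd scal)
   \<Rightarrow> (nat \<Rightarrow> 'd vec_field) \<Rightarrow> (nat \<Rightarrow> 'd scal) \<Rightarrow> (nat \<Rightarrow> 'd scal) \<Rightarrow> bool" where
  "HMDGFE_solution k Th perm \<phi> visc dm dl dt q cstar T M u p l \<sigma> c lc \<longleftrightarrow>
     (let \<Delta>t = T / real M in
      c 0 \<in> Lambda_h k Th \<and>
      (\<forall>n\<in>{1..M}.
         (u n, p n, l n) \<in> Theta_h k Th \<times> Lambda_h k Th \<times> Sigma_h k Th \<and>
         (\<sigma> n, c n, lc n) \<in> Theta_h k Th \<times> Lambda_h k Th \<times> Sigma_h k Th \<and>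
         (\<forall>\<tau>\<in>Theta_h k Th. \<forall>v\<in>Lambda_h k Th. \<forall>m\<in>Sigma_h k Th.
            B_u Th perm visc (c (n - 1)) (u n, p n, l n) (\<tau>, v, m)
              = - elements_int Th (\<lambda>K x. q x (real n * \<Delta>t) * v K x) \<and>
            B_c Th \<phi> dm dl dt \<Delta>t (u n) (\<sigma> n, c n, lc n) (\<tau>, v, m)
              = - elements_int Th (\<lambda>K x.
                  (q x (real n * \<Delta>t)
                     * ext_conc (\<lambda>y. q y (real n * \<Delta>t)) (\<lambda>y. cstar y (real n * \<Delta>t)) (c n) K x
                   + \<phi> x / \<Delta>t * c (n - 1) K x) * v K x))))"

end

theory Submission
  imports Defs
begin

text \<open>Each of the four conservation laws is the discrete problem tested with one function of the
  discrete spaces.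

  The indicator function of an element \<open>K\<close> lies in \<open>\<Lambda>\<^sub>h\<close> and has zero gradient, so testing with it
  alone leaves only the fluxes through \<open>\<partial>K\<close> and the volume terms on \<open>K\<close>: these are the two local laws.
  For the flow equation this is already the claim. For the concentration equation the volume
  integral and the upwind flux have to be split into the summands of the claim, so these must be
  shown integrable: on the elements, where \<open>\<phi>\<close> and \<open>q\<close> are only given as integrable on the open set \<open>\<Omega>\<close>,
  because \<open>\<partial>\<Omega>\<close> is a null set (\<open>set_integrable_times_continuous\<close>, \<open>set_integrable_source\<close>), and on the
  faces because the surface measure of a face is finite (\<open>upwind_flux_split\<close>).

  A multiplier \<open>m\<close> supported on one interior face \<open>e\<close> leaves only the fluxes through \<open>e\<close>, weighted
  with \<open>m\<close>, from the elements that have \<open>e\<close> as a facet. There are exactly two of them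
  (\<open>elements_with_common_facet\<close>): by convexity two elements on the same side of \<open>e\<close> would overlap. With \<open>m = 1\<close>
  on \<open>e\<close> this is the balance of the concentration fluxes. For the flow, take \<open>m\<close> to be the jump of the
  normal flux itself. This is admissible since normal traces of \<open>RT\<^sub>k\<close> fields are in \<open>P\<^sub>k(e)\<close>
  (\<open>RT_normal_trace\<close>). The integral of the squared jump then vanishes, and the jump, being continuous, vanishes at
  every point of \<open>e\<close> because relatively open subsets of a face have positive surface measure
  (\<open>zero_if_surface_integral_zero\<close>).\<close>

section \<open>Facets of full-dimensional polytopes\<close>

lemma facet_exposed_by_unit_normal:
  fixes K :: "(real^'d) set"
  assumes "polytope K" "e facet_of K"
  shows "\<exists>n b. norm n = 1 \<and> K \<subseteq> {x. n \<bullet> x \<le> b} \<and> e = K \<inter> {x. n \<bullet> x = b}"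
proof -
  have ef: "e face_of K" "e \<noteq> {}" "e \<noteq> K"
    using assms(2) by (auto simp: facet_of_def)
  then have "e exposed_face_of K"
    using exposed_face_of_polyhedron polytope_imp_polyhedron assms(1) by blast
  then obtain a b where ab: "K \<subseteq> {x. a \<bullet> x \<le> b}" "e = K \<inter> {x. a \<bullet> x = b}"
    by (auto simp: exposed_face_of_def)
  have "a \<noteq> 0"
    using ab ef by (cases "b = 0") auto
  then have "(a /\<^sub>R norm a) \<bullet> x \<le> b / norm a \<longleftrightarrow> a \<bullet> x \<le> b"
    and "(a /\<^sub>R norm a) \<bullet> x = b / norm a \<longleftrightarrow> a \<bullet> x = b" for x
    by (auto simp: field_simps)
  with ab \<open>a \<noteq> 0\<close> show ?thesis
    by (intro exI[of _ "a /\<^sub>R norm a"] exI[of _ "b / norm a"]) auto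
qed

lemma affine_hull_facet:
  fixes K :: "(real^'d) set"
  assumes "interior K \<noteq> {}" "e facet_of K" "n \<noteq> 0" "e \<subseteq> {x. n \<bullet> x = b}"
  shows "affine hull e = {x. n \<bullet> x = b}"
proof (rule affine_dim_equal)
  show "affine hull e \<subseteq> {x. n \<bullet> x = b}"
    using assms(4) by (simp add: affine_hyperplane hull_minimal)
  have "aff_dim K = int CARD('d)"
    using aff_dim_nonempty_interior[OF assms(1)] by simp
  then show "aff_dim (affine hull e) = aff_dim {x. n \<bullet> x = b}"
    using assms(2,3) by (simp add: facet_of_def aff_dim_hyperplane)
  show "affine hull e \<noteq> {}"
    using assms(2) by (simp add: facet_of_def)
qed (auto simp: affine_hyperplane)

text \<open>The component of \<open>n'\<close> orthogonal to \<open>n\<close> is a direction of the first hyperplane, so it is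
  also orthogonal to \<open>n'\<close> and vanishes.\<close>

lemma unit_normals_of_hyperplane:
  fixes n n' :: "'a::euclidean_space"
  assumes "norm n = 1" "norm n' = 1" "{x. n \<bullet> x = b} \<subseteq> {x. n' \<bullet> x = b'}"
  shows "n' = n \<or> n' = - n"
proof -
  define y where "y = n' - (n' \<bullet> n) *\<^sub>R n"
  have nn: "n \<bullet> n = 1" "n' \<bullet> n' = 1"
    using assms(1,2) by (simp_all add: dot_square_norm)
  have ny: "n \<bullet> y = 0"
    by (simp add: y_def inner_diff_right nn inner_commute)
  have "b *\<^sub>R n \<in> {x. n' \<bullet> x = b'}" "b *\<^sub>R n + y \<in> {x. n' \<bullet> x = b'}"
    using nn ny by (intro subsetD[OF assms(3)]; simp add: inner_add_right)+
  then have "n' \<bullet> y = 0"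
    by (simp add: inner_add_right)
  then have "y \<bullet> y = 0"
    using ny by (simp add: y_def inner_diff_left inner_commute)
  then have eq: "n' = (n' \<bullet> n) *\<^sub>R n"
    by (simp add: y_def)
  then have "1 = \<bar>n' \<bullet> n\<bar>"
    using assms(1,2) by (metis norm_scaleR mult.right_neutral)
  then have "n' \<bullet> n = 1 \<or> n' \<bullet> n = - 1" by linarith
  then show ?thesis
    using eq by (metis scaleR_one scaleR_minus1_left)
qed

text \<open>The supporting hyperplane of a facet is its affine hull, so the unit normal is determined up
  to sign, and the nonempty interior of \<open>K\<close> decides the sign. Hence the definite description in the
  definition of the outward normal denotes.\<close>

lemma outward_normal_exposes:
  fixes K :: "(real^'d) set"
  assumes "polytope K" "interior K \<noteq> {}" "e facet_of K"
  shows "\<exists>b. norm (outward_normal K e) = 1 \<and> K \<subseteq> {x. outward_normal K e \<bullet> x \<le> b} \<and>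
             e = K \<inter> {x. outward_normal K e \<bullet> x = b}"
proof -
  let ?P = "\<lambda>n. norm n = 1 \<and> (\<exists>b. K \<subseteq> {x. n \<bullet> x \<le> b} \<and> e = K \<inter> {x. n \<bullet> x = b})"
  obtain n where n: "?P n"
    using facet_exposed_by_unit_normal[OF assms(1,3)] by blast
  have "m = n" if m: "?P m" for m
  proof -
    obtain b where b: "K \<subseteq> {x. n \<bullet> x \<le> b}" "e = K \<inter> {x. n \<bullet> x = b}" using n by blast
    obtain b' where b': "K \<subseteq> {x. m \<bullet> x \<le> b'}" "e = K \<inter> {x. m \<bullet> x = b'}" using m by blast
    have "n \<noteq> 0" "m \<noteq> 0" using n m by auto
    then have hull: "affine hull e = {x. n \<bullet> x = b}" "affine hull e = {x. m \<bullet> x = b'}"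
      using affine_hull_facet[OF assms(2,3) \<open>n \<noteq> 0\<close>, of b]
        affine_hull_facet[OF assms(2,3) \<open>m \<noteq> 0\<close>, of b'] b(2) b'(2) by blast+
    then have "m = n \<or> m = - n"
      using n m by (intro unit_normals_of_hyperplane[of n m b b']) simp_all
    moreover have "m \<noteq> - n"
    proof
      \<comment> \<open>opposite supporting half-spaces would squeeze \<open>K\<close> into the hyperplane\<close>
      assume mn: "m = - n"
      obtain z where "z \<in> e" using assms(3) by (auto simp: facet_of_def)
      then have "n \<bullet> z = b" "m \<bullet> z = b'" using b(2) b'(2) by blast+
      then have "b' = - b" using mn by simp
      then have "K \<subseteq> {x. n \<bullet> x = b}"
        using b(1) b'(1) mn by (force intro: antisym)
      then have "interior K \<subseteq> interior {x. n \<bullet> x = b}" by (rule interior_mono)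
      then show False using assms(2) \<open>n \<noteq> 0\<close> by (simp add: interior_hyperplane)
    qed
    ultimately show ?thesis by blast
  qed
  then have "?P (outward_normal K e)"
    unfolding outward_normal_def by (rule theI[of ?P, OF n])
  then show ?thesis by blast
qed

lemma interior_below_facet_hyperplane:
  fixes n :: "'a::euclidean_space"
  assumes "n \<noteq> 0" "K \<subseteq> {x. n \<bullet> x \<le> b}" "y \<in> interior K"
  shows "n \<bullet> y < b"
  using interior_mono[OF assms(2)] assms(1,3) by auto

text \<open>Move a relative interior point \<open>x\<close> of the common facet slightly towards an interior point
  \<open>y1\<close> of \<open>K1\<close>. If \<open>y2\<close> is an interior point of \<open>K2\<close> at the same height as \<open>y1\<close>, the resulting
  point is also a convex combination of \<open>y2\<close> and a base point that is still in the facet, so it is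
  interior to \<open>K2\<close> as well.\<close>

lemma interiors_meet_on_same_side:
  fixes K1 K2 e :: "'a::euclidean_space set"
  assumes conv: "convex K1" "convex K2" and ne: "interior K1 \<noteq> {}" "interior K2 \<noteq> {}"
    and n: "n \<noteq> 0" "K1 \<subseteq> {x. n \<bullet> x \<le> b}" "K2 \<subseteq> {x. n \<bullet> x \<le> b}"
    and e: "convex e" "e \<noteq> {}" "e \<subseteq> K1" "e \<subseteq> K2" "affine hull e = {x. n \<bullet> x = b}"
  shows "interior K1 \<inter> interior K2 \<noteq> {}"
proof -
  obtain x where "x \<in> rel_interior e"
    using e(1,2) rel_interior_eq_empty by blast
  then obtain r where x: "x \<in> e" and r: "r > 0" "ball x r \<inter> affine hull e \<subseteq> e"
    by (auto simp: mem_rel_interior_ball)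
  have nx: "n \<bullet> x = b" using x e(5) hull_subset[of e affine] by auto
  have shrink: "x + s *\<^sub>R (y - x) \<in> interior K"
    if "convex K" "z \<in> interior K" "e \<subseteq> K" "0 < s" "s \<le> 1" "y = z" for K y z and s :: real
    using mem_interior_convex_shrink[OF that(1,2), of x s] that x
    by (auto simp: algebra_simps)
  obtain z1 z2 where z: "z1 \<in> interior K1" "z2 \<in> interior K2" using ne by auto
  \<comment> \<open>first replace \<open>z1\<close>, \<open>z2\<close> by interior points at a common depth \<open>h\<close> below the facet\<close>
  define h1 h2 h where "h1 = b - n \<bullet> z1" and "h2 = b - n \<bullet> z2" and "h = min h1 h2"
  have h: "h1 > 0" "h2 > 0" "h > 0" "h \<le> h1" "h \<le> h2"
    using interior_below_facet_hyperplane[OF n(1,2) z(1)]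
      interior_below_facet_hyperplane[OF n(1,3) z(2)] by (auto simp: h1_def h2_def h_def)
  define y1 y2 where "y1 = x + (h / h1) *\<^sub>R (z1 - x)" and "y2 = x + (h / h2) *\<^sub>R (z2 - x)"
  have y: "y1 \<in> interior K1" "y2 \<in> interior K2"
    unfolding y1_def y2_def using h by (auto intro!: shrink conv z e)
  have "n \<bullet> y1 = b - h" "n \<bullet> y2 = b - h"
  proof -
    have "n \<bullet> z1 - n \<bullet> x = - h1" "n \<bullet> z2 - n \<bullet> x = - h2"
      using nx by (simp_all add: h1_def h2_def)
    then show "n \<bullet> y1 = b - h" "n \<bullet> y2 = b - h"
      using h nx by (simp_all add: y1_def y2_def inner_add_right inner_diff_right)
  qed
  then have same_height: "n \<bullet> (y1 - y2) = 0" by (simp add: inner_diff_right)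
  \<comment> \<open>\<open>s\<close> is small enough that the base point \<open>x'\<close> stays in the relative ball of radius \<open>r\<close>\<close>
  define s where "s = min (1/2) (r / (norm (y1 - y2) + 1) / 4)"
  have "s \<le> 1/2" unfolding s_def by (rule min.cobounded1)
  moreover have "0 < s" using r(1) by (simp add: s_def add_nonneg_pos)
  ultimately have s: "0 < s" "s \<le> 1/2" by auto
  define x' where "x' = x + (s / (1 - s)) *\<^sub>R (y1 - y2)"
  have "s / (1 - s) \<le> 2 * s" using s by (simp add: field_simps)
  from mult_right_mono[OF this norm_ge_zero[of "y1 - y2"]]
  have "norm (x' - x) \<le> 2 * s * norm (y1 - y2)"
    using s by (simp add: x'_def)
  also have "\<dots> \<le> 2 * (r / (norm (y1 - y2) + 1) / 4) * norm (y1 - y2)"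
    by (intro mult_right_mono mult_left_mono) (auto simp: s_def)
  also have "\<dots> < r"
  proof -
    have "r * norm (y1 - y2) \<le> r * (norm (y1 - y2) + 1)"
      using r(1) by simp
    then have "r / (norm (y1 - y2) + 1) * norm (y1 - y2) \<le> r"
      by (simp add: divide_le_eq add_nonneg_pos)
    moreover have "2 * (X / 4) * Y < r" if "X * Y \<le> r" for X Y
      using that r(1) by simp
    ultimately show ?thesis by blast
  qed
  finally have "x' \<in> ball x r" by (simp add: dist_norm norm_minus_commute)
  moreover have "x' \<in> affine hull e"
    using e(5) same_height nx by (simp add: x'_def inner_add_right)
  ultimately have "x' \<in> K2" using r(2) e(4) by blast
  have "x + s *\<^sub>R (y1 - x) = x' - s *\<^sub>R (x' - y2)"
  proof -
    have "(1 - s) *\<^sub>R x' = (1 - s) *\<^sub>R x + s *\<^sub>R (y1 - y2)"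
      using s by (simp add: x'_def scaleR_add_right)
    then show ?thesis by (simp add: algebra_simps)
  qed
  moreover have "x' - s *\<^sub>R (x' - y2) \<in> interior K2"
    using mem_interior_convex_shrink[OF conv(2) y(2) \<open>x' \<in> K2\<close>] s by simp
  moreover have "x + s *\<^sub>R (y1 - x) \<in> interior K1"
    using s by (intro shrink[OF conv(1) y(1) e(3)]) auto
  ultimately show ?thesis by auto
qed

text \<open>Both normals are orthogonal to the hyperplane of \<open>e\<close>; if they were equal, the elements would
  lie on the same side of it and overlap.\<close>

lemma outward_normals_opposite:
  fixes K1 K2 :: "(real^'d) set"
  assumes K: "polytope K1" "polytope K2" "interior K1 \<noteq> {}" "interior K2 \<noteq> {}"
    and disj: "interior K1 \<inter> interior K2 = {}" and e: "e facet_of K1" "e facet_of K2"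
  shows "outward_normal K2 e = - outward_normal K1 e"
proof -
  let ?n1 = "outward_normal K1 e" and ?n2 = "outward_normal K2 e"
  obtain b1 where b1: "norm ?n1 = 1" "K1 \<subseteq> {x. ?n1 \<bullet> x \<le> b1}" "e = K1 \<inter> {x. ?n1 \<bullet> x = b1}"
    using outward_normal_exposes K e by blast
  obtain b2 where b2: "norm ?n2 = 1" "K2 \<subseteq> {x. ?n2 \<bullet> x \<le> b2}" "e = K2 \<inter> {x. ?n2 \<bullet> x = b2}"
    using outward_normal_exposes K e by blast
  have nz: "?n1 \<noteq> 0" "?n2 \<noteq> 0" using b1(1) b2(1) by auto
  have hull: "affine hull e = {x. ?n1 \<bullet> x = b1}" "affine hull e = {x. ?n2 \<bullet> x = b2}"
    using affine_hull_facet[OF K(3) e(1) nz(1), of b1] affine_hull_facet[OF K(4) e(2) nz(2), of b2]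
      b1(3) b2(3) by blast+
  have ex: "convex e" "e \<noteq> {}" "e \<subseteq> K1" "e \<subseteq> K2"
    using e facet_of_imp_subset[OF e(1)] facet_of_imp_subset[OF e(2)] K(1)
    by (auto simp: facet_of_def dest: face_of_imp_convex)
  have "?n2 = ?n1 \<or> ?n2 = - ?n1"
    using hull by (intro unit_normals_of_hyperplane[OF b1(1) b2(1), of b1 b2]) simp
  moreover have "?n2 \<noteq> ?n1"
  proof
    assume eq: "?n2 = ?n1"
    obtain x where "x \<in> e" using ex(2) by blast
    then have "?n1 \<bullet> x = b1" "?n2 \<bullet> x = b2" using b1(3) b2(3) by blast+
    then have "b2 = b1" using eq by simp
    then have "interior K1 \<inter> interior K2 \<noteq> {}"
      using K b1(2) b2(2) eq nz ex hull(1)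
      by (intro interiors_meet_on_same_side[of K1 K2 ?n1 b1 e]) (simp_all add: polytope_imp_convex)
    with disj show False by simp
  qed
  ultimately show ?thesis by blast
qed

text \<open>Any two distinct elements that share a facet have opposite normals there, and three vectors
  of norm 1 cannot be pairwise opposite.\<close>

lemma elements_with_common_facet:
  assumes Th: "partition_of_domain \<Omega> Th" and e: "interior_face Th e K1 K2"
  shows "{K \<in> Th. e facet_of K} = {K1, K2}"
proof -
  have *: "outward_normal L e = - outward_normal K e"
    if "K \<in> Th" "L \<in> Th" "K \<noteq> L" "e facet_of K" "e facet_of L" for K L
    using that Th by (intro outward_normals_opposite) (auto simp: partition_of_domain_def)
  have K: "K1 \<in> Th" "K2 \<in> Th" "K1 \<noteq> K2" "e facet_of K1" "e facet_of K2"
    using e by (auto simp: interior_face_def)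
  have "outward_normal K1 e \<noteq> 0"
    using outward_normal_exposes[of K1 e] K Th by (force simp: partition_of_domain_def)
  moreover have "outward_normal K1 e = - outward_normal K1 e"
    if "K \<in> Th" "e facet_of K" "K \<noteq> K1" "K \<noteq> K2" for K
    using *[of K1 K2] *[of K1 K] *[of K K2] that K by simp
  ultimately show ?thesis
    using K by (auto simp: eq_neg_iff_add_eq_0 simp flip: scaleR_2)
qed

section \<open>The surface measure of a face\<close>

lemma sets_surface_measure [measurable_cong, simp]: "sets (surface_measure e) = sets borel"
  by (simp add: surface_measure_def)

lemma space_surface_measure [simp]: "space (surface_measure e) = UNIV"
  by (simp add: surface_measure_def)

lemma emeasure_surface_measure:
  fixes e :: "(real^'d) set"
  assumes "e \<noteq> {}" "A \<in> sets borel"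
  shows "emeasure (surface_measure e) A =
    emeasure lborel ({x. infdist x (affine hull e) \<le> 1/2} \<inter> closest_point (affine hull e) -` A)"
proof -
  let ?S = "{x. infdist x (affine hull e) \<le> 1/2}" and ?p = "closest_point (affine hull e)"
  have H: "convex (affine hull e)" "closed (affine hull e)" "affine hull e \<noteq> {}"
    using assms(1) by (auto simp: affine_imp_convex closed_affine_hull)
  have "?p \<in> borel_measurable borel"
    using H by (intro borel_measurable_continuous_onI continuous_on_closest_point)
  then have p: "?p \<in> borel_measurable (restrict_space lborel ?S)"
    by (intro measurable_restrict_space1) simp
  have "closed ?S"
    by (intro closed_Collect_le continuous_intros)
  then have S: "?S \<in> sets borel" by simp
  have "emeasure (surface_measure e) A = emeasure (restrict_space lborel ?S) (?p -` A \<inter> ?S)"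
    unfolding surface_measure_def using p assms(2)
    by (subst emeasure_distr) (auto simp: space_restrict_space)
  also have "\<dots> = emeasure lborel (?S \<inter> ?p -` A)"
    using S by (subst emeasure_restrict_space) (auto simp: Int_commute)
  finally show ?thesis .
qed

text \<open>The prism over a bounded set is bounded.\<close>

lemma emeasure_surface_measure_finite:
  fixes e :: "(real^'d) set"
  assumes "e \<noteq> {}" "A \<in> sets borel" "bounded A"
  shows "emeasure (surface_measure e) A < \<infinity>"
proof -
  let ?H = "affine hull e"
  obtain B where B: "\<And>x. x \<in> A \<Longrightarrow> norm x \<le> B"
    using assms(3) by (auto simp: bounded_iff)
  have H: "closed ?H" "?H \<noteq> {}" using assms(1) by (auto simp: closed_affine_hull)
  have "norm x \<le> 1/2 + B" if "infdist x ?H \<le> 1/2" "closest_point ?H x \<in> A" for x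
  proof -
    have "dist x (closest_point ?H x) = infdist x ?H"
      using H by (simp add: infdist_eq_setdist setdist_closest_point)
    then have "norm (x - closest_point ?H x) \<le> 1/2"
      using that(1) by (simp add: dist_norm)
    then show ?thesis
      using B[OF that(2)] norm_triangle_sub[of x "closest_point ?H x"] by linarith
  qed
  then have "bounded ({x. infdist x ?H \<le> 1/2} \<inter> closest_point ?H -` A)"
    unfolding bounded_iff by blast
  then show ?thesis
    unfolding emeasure_surface_measure[OF assms(1,2)] by (rule emeasure_bounded_finite)
qed

text \<open>The prism over a relative ball contains a full-dimensional ball, because the orthogonal
  projection is 1-Lipschitz.\<close>

lemma emeasure_surface_measure_pos:
  fixes e :: "(real^'d) set"
  assumes "y \<in> affine hull e" "r > 0" "ball y r \<inter> affine hull e \<subseteq> A" "A \<in> sets borel"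
  shows "emeasure (surface_measure e) A \<noteq> 0"
proof -
  let ?H = "affine hull e"
  have e: "e \<noteq> {}" using assms(1) by auto
  have H: "convex ?H" "closed ?H" "?H \<noteq> {}"
    using assms(1) by (auto simp: affine_imp_convex closed_affine_hull)
  let ?P = "{x. infdist x ?H \<le> 1/2} \<inter> closest_point ?H -` A"
  have sub: "ball y (min r (1/2)) \<subseteq> ?P"
  proof
    fix x assume x: "x \<in> ball y (min r (1/2))"
    have "infdist x ?H \<le> dist x y" using assms(1) by (rule infdist_le)
    moreover have "dist y (closest_point ?H x) \<le> dist y x"
      using closest_point_lipschitz[OF H, of y x] closest_point_self[OF assms(1)] by simp
    moreover have "closest_point ?H x \<in> ?H" using H by (simp add: closest_point_in_set)
    ultimately show "x \<in> ?P"
      using x assms(3) by (auto simp: dist_commute)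
  qed
  have P: "?P \<in> sets borel"
  proof (intro sets.Int)
    have "closed {x. infdist x ?H \<le> 1/2}" by (intro closed_Collect_le continuous_intros)
    then show "{x. infdist x ?H \<le> 1/2} \<in> sets borel" by simp
    have "closest_point ?H \<in> borel_measurable borel"
      using H by (intro borel_measurable_continuous_onI continuous_on_closest_point)
    from measurable_sets[OF this assms(4)] show "closest_point ?H -` A \<in> sets borel" by simp
  qed
  have "\<not> negligible (ball y (min r (1/2)))"
    using assms(2) by (intro open_not_negligible) auto
  then have "emeasure lborel (ball y (min r (1/2))) \<noteq> 0"
    by (simp add: negligible_iff_emeasure0)
  with emeasure_mono[OF sub, of lborel] P have "emeasure lborel ?P \<noteq> 0"
    by auto
  then show ?thesis
    using e assms(4) by (simp add: emeasure_surface_measure)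
qed

text \<open>A continuous function on a compact face is bounded, and the face has finite measure.\<close>

lemma set_integrable_surface_continuous:
  fixes f :: "real^'d \<Rightarrow> real"
  assumes "compact e" "continuous_on e f"
  shows "set_integrable (surface_measure e) e f"
proof (cases "e = {}")
  case True
  then show ?thesis by (simp add: set_integrable_def)
next
  case False
  have e: "e \<in> sets borel" using assms(1) by (simp add: borel_compact)
  obtain B where B: "\<And>x. x \<in> e \<Longrightarrow> norm (f x) \<le> B"
    using compact_imp_bounded[OF compact_continuous_image[OF assms(2,1)]] by (auto simp: bounded_iff)
  have "(\<lambda>x. indicator e x *\<^sub>R f x) \<in> borel_measurable (surface_measure e)"
    using borel_measurable_continuous_on_indicator[OF e assms(2)]
    by (simp add: measurable_cong_sets[OF sets_surface_measure refl])
  then have "integrable (surface_measure e) (\<lambda>x. indicator e x *\<^sub>R (indicator e x *\<^sub>R f x))"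
    using e emeasure_surface_measure_finite[OF False e] B assms(1)
    by (intro integrableI_bounded_set_indicator[where B = B]) (auto dest: compact_imp_bounded)
  then show ?thesis
    by (simp add: set_integrable_def mult.assoc[symmetric] flip: indicator_inter_arith)
qed

text \<open>A positive value persists on a relative ball around a point of the relative interior of the
  face, which has positive surface measure.\<close>

lemma zero_if_surface_integral_zero:
  fixes f :: "real^'d \<Rightarrow> real"
  assumes e: "compact e" "convex e" and f: "continuous_on e f" "\<And>x. x \<in> e \<Longrightarrow> 0 \<le> f x"
    and int: "(LINT x:e|surface_measure e. f x) = 0" and x: "x \<in> e"
  shows "f x = 0"
proof (rule ccontr)
  assume "f x \<noteq> 0"
  then have fx: "f x > 0" using f(2)[OF x] by simp
  let ?M = "surface_measure e"
  have eb: "e \<in> sets borel" using e(1) by (simp add: borel_compact)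
  have "integrable ?M (\<lambda>x. indicator e x *\<^sub>R f x)"
    using set_integrable_surface_continuous[OF e(1) f(1)] by (simp add: set_integrable_def)
  then have ae: "AE x in ?M. indicator e x *\<^sub>R f x = 0"
    using int f(2) unfolding set_lebesgue_integral_def
    by (subst (asm) integral_nonneg_eq_0_iff_AE) (auto simp: indicator_def)
  obtain d where d: "d > 0" "\<And>y. y \<in> e \<Longrightarrow> dist y x < d \<Longrightarrow> dist (f y) (f x) < f x"
    using f(1) x fx unfolding continuous_on_iff by metis
  have pos: "f y > 0" if "y \<in> e" "dist y x < d" for y
    using d(2)[OF that] by (auto simp: dist_real_def)
  have "x \<in> closure (rel_interior e)"
    using convex_closure_rel_interior[OF e(2)] x closure_subset by auto
  then obtain y where y: "y \<in> rel_interior e" "dist y x < d"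
    using d(1) by (auto simp: closure_approachable)
  then obtain r where r: "y \<in> e" "r > 0" "ball y r \<inter> affine hull e \<subseteq> e"
    by (auto simp: mem_rel_interior_ball)
  have "ball y (min r (d - dist y x)) \<inter> affine hull e \<subseteq> e \<inter> ball x d"
  proof
    fix z assume z: "z \<in> ball y (min r (d - dist y x)) \<inter> affine hull e"
    have "dist x z \<le> dist y x + dist y z" by (metis dist_commute dist_triangle)
    then show "z \<in> e \<inter> ball x d" using z r(3) by auto
  qed
  then have "emeasure ?M (e \<inter> ball x d) \<noteq> 0"
    using y r eb hull_subset[of e affine]
    by (intro emeasure_surface_measure_pos[of y e "min r (d - dist y x)"]) auto
  moreover have "AE z in ?M. z \<notin> e \<inter> ball x d"
    using ae
  proof eventually_elim
    case (elim z)
    then show ?case using pos[of z] by (auto simp: dist_commute)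
  qed
  then have "emeasure ?M (e \<inter> ball x d) = 0"
    using eb by (subst (asm) AE_iff_measurable[of "e \<inter> ball x d"]) auto
  ultimately show False by simp
qed

section \<open>Polynomial traces\<close>

lemma finite_multi_indices: "finite {\<alpha> :: 'd::finite \<Rightarrow> nat. (\<Sum>i\<in>UNIV. \<alpha> i) \<le> k}"
proof (rule finite_subset)
  show "{\<alpha> :: 'd \<Rightarrow> nat. (\<Sum>i\<in>UNIV. \<alpha> i) \<le> k} \<subseteq> PiE UNIV (\<lambda>_. {..k})"
  proof safe
    fix \<alpha> :: "'d \<Rightarrow> nat" and i
    assume "(\<Sum>i\<in>UNIV. \<alpha> i) \<le> k"
    moreover have "\<alpha> i \<le> (\<Sum>i\<in>UNIV. \<alpha> i)" by (rule member_le_sum) auto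
    ultimately show "\<alpha> i \<le> k" by simp
  qed simp
qed (simp add: finite_PiE)

lemma polys_subset: "f \<in> polys k S \<Longrightarrow> T \<subseteq> S \<Longrightarrow> f \<in> polys k T"
  by (auto simp: polys_def)

lemma polys_cong: "f \<in> polys k S \<Longrightarrow> (\<And>x. x \<in> S \<Longrightarrow> g x = f x) \<Longrightarrow> g \<in> polys k S"
  by (simp add: polys_def)

lemma polys_const: "(\<lambda>x :: real^'d. r) \<in> polys k S"
  unfolding polys_def
proof (intro CollectI exI[of _ "\<lambda>\<alpha>. if \<alpha> = (\<lambda>_. 0) then r else 0"] ballI)
  fix x :: "real^'d"
  have "(\<Sum>\<alpha> :: 'd \<Rightarrow> nat | (\<Sum>i\<in>UNIV. \<alpha> i) \<le> k.
          (if \<alpha> = (\<lambda>_. 0) then r else 0) * (\<Prod>i\<in>UNIV. (x $ i) ^ \<alpha> i))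
      = (\<Sum>\<alpha> :: 'd \<Rightarrow> nat | (\<Sum>i\<in>UNIV. \<alpha> i) \<le> k. if \<alpha> = (\<lambda>_. 0) then r else 0)"
    by (intro sum.cong) auto
  then show "r = (\<Sum>\<alpha> :: 'd \<Rightarrow> nat | (\<Sum>i\<in>UNIV. \<alpha> i) \<le> k.
          (if \<alpha> = (\<lambda>_. 0) then r else 0) * (\<Prod>i\<in>UNIV. (x $ i) ^ \<alpha> i))"
    by (simp add: finite_multi_indices)
qed

lemma polys_add:
  assumes "f \<in> polys k S" "g \<in> polys k S"
  shows "(\<lambda>x. f x + g x) \<in> polys k S"
proof -
  obtain a b where "\<forall>x\<in>S. f x = (\<Sum>\<alpha> | (\<Sum>i\<in>UNIV. \<alpha> i) \<le> k. a \<alpha> * (\<Prod>i\<in>UNIV. (x $ i) ^ \<alpha> i))"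
    "\<forall>x\<in>S. g x = (\<Sum>\<alpha> | (\<Sum>i\<in>UNIV. \<alpha> i) \<le> k. b \<alpha> * (\<Prod>i\<in>UNIV. (x $ i) ^ \<alpha> i))"
    using assms by (auto simp: polys_def)
  then show ?thesis
    unfolding polys_def
    by (intro CollectI exI[of _ "\<lambda>\<alpha>. a \<alpha> + b \<alpha>"]) (simp add: sum.distrib distrib_right)
qed

lemma polys_mult_const:
  assumes "f \<in> polys k S"
  shows "(\<lambda>x. f x * r) \<in> polys k S"
proof -
  obtain a where "\<forall>x\<in>S. f x = (\<Sum>\<alpha> | (\<Sum>i\<in>UNIV. \<alpha> i) \<le> k. a \<alpha> * (\<Prod>i\<in>UNIV. (x $ i) ^ \<alpha> i))"
    using assms by (auto simp: polys_def)
  then show ?thesis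
    unfolding polys_def
    by (intro CollectI exI[of _ "\<lambda>\<alpha>. r * a \<alpha>"]) (simp add: sum_distrib_left mult_ac)
qed

lemma polys_sum:
  assumes "\<And>i. i \<in> I \<Longrightarrow> f i \<in> polys k S"
  shows "(\<lambda>x. \<Sum>i\<in>I. f i x) \<in> polys k S"
  using assms by (induction I rule: infinite_finite_induct) (auto intro: polys_add polys_const)

lemma continuous_on_polys:
  assumes "f \<in> polys k S"
  shows "continuous_on S f"
proof -
  obtain a where a: "\<And>x. x \<in> S \<Longrightarrow>
      f x = (\<Sum>\<alpha> | (\<Sum>i\<in>UNIV. \<alpha> i) \<le> k. a \<alpha> * (\<Prod>i\<in>UNIV. (x $ i) ^ \<alpha> i))"
    using assms by (auto simp: polys_def)
  have "continuous_on S (\<lambda>x. \<Sum>\<alpha> | (\<Sum>i\<in>UNIV. \<alpha> i) \<le> k. a \<alpha> * (\<Prod>i\<in>UNIV. (x $ i) ^ \<alpha> i))"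
    by (intro continuous_intros)
  then show ?thesis using a by (simp cong: continuous_on_cong)
qed

text \<open>The enriching part \<open>s x *\<^sub>R x\<close> of a Raviart-Thomas field has degree \<open>k + 1\<close>, but
  \<open>x \<bullet> n\<close> is constant on the hyperplane of a face, so the normal trace is again in \<open>P\<^sub>k\<close>.\<close>

lemma RT_normal_trace:
  fixes w :: "real^'d \<Rightarrow> real^'d"
  assumes "w \<in> RT k K" "e \<subseteq> K" "e \<subseteq> {x. n \<bullet> x = b}"
  shows "(\<lambda>x. w x \<bullet> n) \<in> polys k e"
proof -
  obtain g s where g: "\<And>i. (\<lambda>x. g x $ i) \<in> polys k K" and s: "s \<in> polys k K"
    and w: "\<And>x. x \<in> K \<Longrightarrow> w x = g x + s x *\<^sub>R x"
    using assms(1) by (auto simp: RT_def)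
  have "(\<lambda>x. (\<Sum>i\<in>UNIV. g x $ i * n $ i) + s x * b) \<in> polys k e"
    using g s assms(2) by (intro polys_add polys_sum polys_mult_const) (auto intro: polys_subset)
  moreover have "w x \<bullet> n = (\<Sum>i\<in>UNIV. g x $ i * n $ i) + s x * b" if "x \<in> e" for x
  proof -
    have "x \<bullet> n = b" using assms(3) that by (auto simp: inner_commute)
    then show ?thesis
      using w[of x] that assms(2) by (auto simp: inner_add_left inner_vec_def[of "g x"])
  qed
  ultimately show ?thesis by (rule polys_cong)
qed

section \<open>Integrals over the elements\<close>

text \<open>The boundary is covered by the boundaries of finitely many convex sets.\<close>

lemma negligible_frontier_polyhedral_domain:
  assumes "polyhedral_domain \<Omega>"
  shows "negligible (frontier \<Omega>)"
proof -
  obtain \<P> where P: "finite \<P>" "\<And>P. P \<in> \<P> \<Longrightarrow> polytope P" "\<Omega> = interior (\<Union>\<P>)"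
    using assms by (auto simp: polyhedral_domain_def)
  have "frontier \<Omega> \<subseteq> (\<Union>P\<in>\<P>. frontier P)"
    using frontier_interior_subset[of "\<Union>\<P>"] frontier_Union_subset[OF P(1)] P(3) by auto
  moreover have "negligible (\<Union>P\<in>\<P>. frontier P)"
    using P(1,2) by (intro negligible_Union) (auto intro: negligible_convex_frontier polytope_imp_convex)
  ultimately show ?thesis by (rule negligible_subset[rotated])
qed

lemma set_integrable_ignore_frontier:
  fixes f :: "real^'d \<Rightarrow> real"
  assumes "negligible (frontier \<Omega>)" "K \<subseteq> closure \<Omega>" "set_integrable lebesgue (K \<inter> \<Omega>) f"
  shows "set_integrable lebesgue K f"
proof -
  have "negligible {x \<in> K - K \<inter> \<Omega>. f x \<noteq> 0}"
    using assms(1,2) by (elim negligible_subset) (auto simp: closure_Un_frontier)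
  moreover have "negligible {x \<in> K \<inter> \<Omega> - K. f x \<noteq> 0}" by (rule negligible_subset[of "{}"]) auto
  ultimately show ?thesis
    using absolutely_integrable_spike_set_eq[of K "K \<inter> \<Omega>" f] assms(3) by blast
qed

lemma set_integrable_times_continuous:
  fixes f g :: "real^'d \<Rightarrow> real"
  assumes \<Omega>: "open \<Omega>" "negligible (frontier \<Omega>)" and f: "set_integrable lebesgue \<Omega> f"
    and K: "compact K" "K \<subseteq> closure \<Omega>" and g: "continuous_on K g"
  shows "set_integrable lebesgue K (\<lambda>x. f x * g x)"
proof -
  have Kl: "K \<in> sets lebesgue" using K(1) by (simp add: lmeasurable_compact fmeasurableD)
  have "set_integrable lebesgue (K \<inter> \<Omega>) f"
    using Kl \<Omega>(1) by (intro set_integrable_subset[OF f] sets.Int) auto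
  then have "f absolutely_integrable_on K"
    using \<Omega>(2) K(2) set_integrable_ignore_frontier by blast
  moreover have "g \<in> borel_measurable (lebesgue_on K)"
    using g Kl by (rule continuous_imp_measurable_on_sets_lebesgue)
  moreover have "bounded (g ` K)"
    using g K(1) by (intro compact_imp_bounded compact_continuous_image)
  ultimately have "(\<lambda>x. g x * f x) absolutely_integrable_on K"
    by (intro absolutely_integrable_bounded_measurable_product[OF bilinear_times _ Kl])
  then show ?thesis by (simp add: mult.commute)
qed

text \<open>On the injection set \<open>{q > 0}\<close> the source term is the integrable \<open>q c\<^sup>*\<close>, elsewhere it is
  \<open>q\<close> times a function that is continuous on \<open>K\<close>.\<close>

lemma set_integrable_source:
  fixes q cs :: "real^'d \<Rightarrow> real"
  assumes \<Omega>: "open \<Omega>" "negligible (frontier \<Omega>)" and q: "set_integrable lebesgue \<Omega> q"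
    and qc: "set_integrable lebesgue {x \<in> \<Omega>. q x > 0} (\<lambda>x. q x * cs x)"
    and K: "compact K" "K \<subseteq> closure \<Omega>" and c: "continuous_on K (c K)"
  shows "set_integrable lebesgue K (\<lambda>x. q x * ext_conc q cs c K x)"
proof (rule set_integrable_ignore_frontier[OF \<Omega>(2) K(2)])
  let ?P = "{x \<in> \<Omega>. q x > 0}"
  have Kl: "K \<in> sets lebesgue" using K(1) by (simp add: lmeasurable_compact fmeasurableD)
  have Ol: "\<Omega> \<in> sets lebesgue" using \<Omega>(1) by auto
  have "(\<lambda>x. indicator \<Omega> x *\<^sub>R q x) \<in> borel_measurable lebesgue"
    using q by (simp add: set_integrable_def borel_measurable_integrable)
  then have "{x \<in> space lebesgue. 0 < indicator \<Omega> x *\<^sub>R q x} \<in> sets lebesgue"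
    by (intro borel_measurable_less) auto
  moreover have "{x \<in> space lebesgue. 0 < indicator \<Omega> x *\<^sub>R q x} = ?P"
    by (auto simp: indicator_def)
  ultimately have Pl: "?P \<in> sets lebesgue" by simp
  have "set_integrable lebesgue (K \<inter> ?P) (\<lambda>x. q x * cs x)"
    using Kl Pl by (intro set_integrable_subset[OF qc]) auto
  then have 1: "set_integrable lebesgue (K \<inter> ?P) (\<lambda>x. q x * ext_conc q cs c K x)"
    by (subst set_integrable_cong[OF refl refl]) (auto simp: ext_conc_def)
  have "set_integrable lebesgue (K \<inter> (\<Omega> - ?P)) (\<lambda>x. q x * c K x)"
    using Kl Pl Ol
    by (intro set_integrable_subset[OF set_integrable_times_continuous[OF \<Omega> q K c]]) auto
  then have 2: "set_integrable lebesgue (K \<inter> (\<Omega> - ?P)) (\<lambda>x. q x * ext_conc q cs c K x)"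
    by (subst set_integrable_cong[OF refl refl]) (auto simp: ext_conc_def)
  have "K \<inter> \<Omega> = K \<inter> ?P \<union> K \<inter> (\<Omega> - ?P)" by auto
  then show "set_integrable lebesgue (K \<inter> \<Omega>) (\<lambda>x. q x * ext_conc q cs c K x)"
    using set_integrable_Un[OF 1 2] Kl Pl Ol by auto
qed

section \<open>Testing the forms\<close>

lemma grad_const [simp]: "grad (\<lambda>_. r) x = 0"
  by (simp add: grad_def frechet_derivative_const vec_eq_iff)

lemma set_integral_zero_fun [simp]: "(LINT x:A|M. (0::real)) = 0"
  by (simp add: set_lebesgue_integral_def)

lemma set_integral_neg [simp]:
  fixes f :: "'a \<Rightarrow> real"
  shows "(LINT x:A|M. - f x) = - (LINT x:A|M. f x)"
  by (simp add: set_lebesgue_integral_def)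

text \<open>Test functions that are constant on every element, together with a vanishing flux test function,
  remove the constitutive equation and all terms with a gradient of a test function.\<close>

lemma B_u_piecewise_constant_test:
  "B_u Th perm visc ct (u, p, l) (\<lambda>_ _. 0, \<lambda>K _. a K, m) =
     skeleton_int Th (\<lambda>K e x. (u K x \<bullet> outward_normal K e) * (m e x - a K))"
  by (simp add: B_u_def elements_int_def skeleton_int_def boundary_int_def)

lemma B_c_piecewise_constant_test:
  "B_c Th \<phi> dm dl dt \<Delta>t w (\<sigma>, c, l) (\<lambda>_ _. 0, \<lambda>K _. a K, m) =
     - (1 / \<Delta>t) * elements_int Th (\<lambda>K x. \<phi> x * c K x * a K) +
     skeleton_int Th (\<lambda>K e x. (\<sigma> K x \<bullet> outward_normal K e +
       (w K x \<bullet> outward_normal K e) * upwind w c l K e x) * (m e x - a K))"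
  by (simp add: B_c_def elements_int_def skeleton_int_def boundary_int_def)

text \<open>The next three identities evaluate the remaining terms for the two kinds of test functions:
  the indicator function of an element, and a multiplier that is supported on one face. The differences with
  \<open>0\<close> are the factor \<open>m - v\<close> of the forms.\<close>

lemma elements_int_single:
  assumes "finite Th" "K \<in> Th"
  shows "elements_int Th (\<lambda>L x. F L x * of_bool (L = K)) = (LINT x:K|lebesgue. F K x)"
proof -
  have "elements_int Th (\<lambda>L x. F L x * of_bool (L = K))
      = (\<Sum>L\<in>Th. if L = K then LINT x:K|lebesgue. F K x else 0)"
    unfolding elements_int_def by (intro sum.cong) auto
  then show ?thesis using assms by simp
qed

lemma skeleton_int_single_element:
  assumes "finite Th" "K \<in> Th"
  shows "skeleton_int Th (\<lambda>L e x. F L e x * (0 - of_bool (L = K))) = - boundary_int K (F K)"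
proof -
  have "skeleton_int Th (\<lambda>L e x. F L e x * (0 - of_bool (L = K)))
      = (\<Sum>L\<in>Th. if L = K then - boundary_int K (F K) else 0)"
    unfolding skeleton_int_def boundary_int_def by (intro sum.cong) (auto simp: sum_negf)
  then show ?thesis using assms by simp
qed

lemma skeleton_int_single_face:
  assumes "finite Th" "\<forall>K\<in>Th. polytope K"
  shows "skeleton_int Th (\<lambda>K e' x. F K e' x * ((if e' = e then f x else 0) - 0)) =
    (\<Sum>K | K \<in> Th \<and> e facet_of K. LINT x:e|surface_measure e. F K e x * f x)"
proof -
  have "boundary_int K (\<lambda>e' x. F K e' x * ((if e' = e then f x else 0) - 0))
      = (if e facet_of K then LINT x:e|surface_measure e. F K e x * f x else 0)" if "K \<in> Th" for K
  proof -
    have fin: "finite {e'. e' facet_of K}" using assms(2) that by (simp add: finite_polytope_facets)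
    have "boundary_int K (\<lambda>e' x. F K e' x * ((if e' = e then f x else 0) - 0))
        = (\<Sum>e' | e' facet_of K. if e' = e then LINT x:e|surface_measure e. F K e x * f x else 0)"
      unfolding boundary_int_def by (intro sum.cong) auto
    then show ?thesis using fin by simp
  qed
  then show ?thesis
    using assms(1) by (simp add: skeleton_int_def sum.If_cases Int_def cong: sum.cong)
qed

text \<open>The upwind value may jump where \<open>w \<bullet> n\<close> changes sign, but it is continuous on each of the
  two Borel sets \<open>outflow\<close> and \<open>inflow\<close>, so the flux is integrable on both.\<close>

lemma upwind_flux_split:
  fixes e :: "(real^'d) set"
  assumes e: "compact e"
    and cont: "continuous_on e (\<lambda>x. \<sigma> K x \<bullet> outward_normal K e)"
      "continuous_on e (\<lambda>x. w K x \<bullet> outward_normal K e)" "continuous_on e (c K)" "continuous_on e (l e)"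
  shows "(LINT x:e|surface_measure e.
      \<sigma> K x \<bullet> outward_normal K e + (w K x \<bullet> outward_normal K e) * upwind w c l K e x)
    = (LINT x:e|surface_measure e. \<sigma> K x \<bullet> outward_normal K e)
    + (LINT x:outflow w K e|surface_measure e. (w K x \<bullet> outward_normal K e) * c K x)
    + (LINT x:inflow w K e|surface_measure e. (w K x \<bullet> outward_normal K e) * l e x)"
proof -
  let ?M = "surface_measure e" and ?O = "outflow w K e" and ?I = "inflow w K e"
  let ?w = "\<lambda>x. w K x \<bullet> outward_normal K e"
  have eb: "e \<in> sets borel" using e by (simp add: borel_compact)
  have "openin (top_of_set e) (e \<inter> ?w -` {0<..})"
    using cont(2) by (intro continuous_openin_preimage_gen) auto
  then obtain U where "open U" "e \<inter> ?w -` {0<..} = e \<inter> U" by (auto simp: openin_open)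
  moreover have "?O = e \<inter> ?w -` {0<..}" by (auto simp: outflow_def)
  ultimately have O: "?O \<in> sets ?M" and I: "?I \<in> sets ?M"
    using eb by (auto simp: inflow_def)
  have sub: "?O \<subseteq> e" "?I \<subseteq> e" "?O \<inter> ?I = {}" "?O \<union> ?I = e"
    by (auto simp: outflow_def inflow_def)
  have "set_integrable ?M ?O (\<lambda>x. ?w x * c K x)"
    using set_integrable_surface_continuous[OF e continuous_on_mult[OF cont(2,3)]] O sub(1)
    by (rule set_integrable_subset)
  then have 1: "set_integrable ?M ?O (\<lambda>x. ?w x * upwind w c l K e x)"
    by (subst set_integrable_cong[OF refl refl]) (auto simp: upwind_def)
  have "set_integrable ?M ?I (\<lambda>x. ?w x * l e x)"
    using set_integrable_surface_continuous[OF e continuous_on_mult[OF cont(2,4)]] I sub(2)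
    by (rule set_integrable_subset)
  then have 2: "set_integrable ?M ?I (\<lambda>x. ?w x * upwind w c l K e x)"
    by (subst set_integrable_cong[OF refl refl]) (auto simp: upwind_def inflow_def)
  have 3: "set_integrable ?M e (\<lambda>x. ?w x * upwind w c l K e x)"
    using set_integrable_Un[OF 1 2 O I] sub(4) by simp
  have "(LINT x:e|?M. \<sigma> K x \<bullet> outward_normal K e + ?w x * upwind w c l K e x)
      = (LINT x:e|?M. \<sigma> K x \<bullet> outward_normal K e) + (LINT x:e|?M. ?w x * upwind w c l K e x)"
    using set_integrable_surface_continuous[OF e cont(1)] 3 by (rule set_integral_add)
  also have "(LINT x:e|?M. ?w x * upwind w c l K e x)
      = (LINT x:?O|?M. ?w x * upwind w c l K e x) + (LINT x:?I|?M. ?w x * upwind w c l K e x)"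
    using set_integral_Un[OF sub(3) 1 2] sub(4) by simp
  also have "(LINT x:?O|?M. ?w x * upwind w c l K e x) = (LINT x:?O|?M. ?w x * c K x)"
    using O by (intro set_lebesgue_integral_cong) (auto simp: upwind_def)
  also have "(LINT x:?I|?M. ?w x * upwind w c l K e x) = (LINT x:?I|?M. ?w x * l e x)"
    using I by (intro set_lebesgue_integral_cong) (auto simp: upwind_def inflow_def)
  finally show ?thesis by simp
qed

section \<open>Conservation\<close>

theorem theorem2p2:
  fixes \<Omega> :: "(real^'d) set" and Th :: "(real^'d) set set" and \<kappa> :: real and k M :: nat
    and perm \<phi> :: "real^'d \<Rightarrow> real" and visc :: "real \<Rightarrow> real"
    and dm dl dt T \<Delta>t :: real and t :: "nat \<Rightarrow> real"
    and q cstar :: "real^'d \<Rightarrow> real \<Rightarrow> real"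
    and u \<sigma> :: "nat \<Rightarrow> 'd vec_field" and p l c lc :: "nat \<Rightarrow> 'd scal"
  assumes dim: "CARD('d) = 2 \<or> CARD('d) = 3"
    and domain: "polyhedral_domain \<Omega>"
    and mesh: "partition_of_domain \<Omega> Th" "quasi_uniform_regular \<kappa> Th"
    and disp: "dm > 0" "dl \<ge> 0" "dt \<ge> 0"
    and time: "T > 0" "M \<ge> 1" "\<Delta>t = T / real M" "\<And>n. t n = real n * \<Delta>t"
    and phi_int: "set_integrable lebesgue \<Omega> \<phi>"
    and q_int: "\<And>n. n \<in> {1..M} \<Longrightarrow> set_integrable lebesgue \<Omega> (\<lambda>x. q x (t n))"
    and qc_int: "\<And>n. n \<in> {1..M} \<Longrightarrow>
      set_integrable lebesgue {x \<in> \<Omega>. q x (t n) > 0} (\<lambda>x. q x (t n) * cstar x (t n))"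
    and sol: "HMDGFE_solution k Th perm \<phi> visc dm dl dt q cstar T M u p l \<sigma> c lc"
  shows "\<forall>n\<in>{1..M}.
    (\<forall>K\<in>Th. boundary_int K (\<lambda>e x. u n K x \<bullet> outward_normal K e)
              = (LINT x:K|lebesgue. q x (t n))) \<and>
    (\<forall>e K1 K2. interior_face Th e K1 K2 \<longrightarrow>
       (\<forall>x\<in>e. u n K1 x \<bullet> outward_normal K1 e + u n K2 x \<bullet> outward_normal K2 e = 0)) \<and>
    (\<forall>K\<in>Th.
       1 / \<Delta>t * (LINT x:K|lebesgue. \<phi> x * (c n K x - c (n - 1) K x))
       + boundary_int K (\<lambda>e x. \<sigma> n K x \<bullet> outward_normal K e)
       + (\<Sum>e | e facet_of K. LINT x:outflow (u n) K e|surface_measure e.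
            (u n K x \<bullet> outward_normal K e) * c n K x)
       + (\<Sum>e | e facet_of K. LINT x:inflow (u n) K e|surface_measure e.
            (u n K x \<bullet> outward_normal K e) * lc n e x)
       = (LINT x:K|lebesgue.
            q x (t n) * ext_conc (\<lambda>y. q y (t n)) (\<lambda>y. cstar y (t n)) (c n) K x)) \<and>
    (\<forall>e K1 K2. interior_face Th e K1 K2 \<longrightarrow>
       (\<Sum>K\<in>{K1, K2}. LINT x:e|surface_measure e.
          \<sigma> n K x \<bullet> outward_normal K e
          + (u n K x \<bullet> outward_normal K e) * upwind (u n) (c n) (lc n) K e x) = 0)"
proof (intro ballI conjI allI impI)
  fix n assume n: "n \<in> {1..M}"
  have tn: "t n = real n * (T / real M)"
    using time(3,4) by simp
  have Th: "finite Th" "\<And>K. K \<in> Th \<Longrightarrow> polytope K" "\<And>K. K \<in> Th \<Longrightarrow> interior K \<noteq> {}"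
      "\<And>K. K \<in> Th \<Longrightarrow> K \<subseteq> closure \<Omega>"
    using mesh(1) by (auto simp: partition_of_domain_def)
  have single_face: "skeleton_int Th (\<lambda>K e' x. F K e' x * ((if e' = e then f x else 0) - 0)) =
      (\<Sum>K\<in>{K1, K2}. LINT x:e|surface_measure e. F K e x * f x)"
    if "interior_face Th e K1 K2" for F f e K1 K2
    using skeleton_int_single_face[of Th F e f] Th elements_with_common_facet[OF mesh(1) that]
    by simp
  have spaces: "u n \<in> Theta_h k Th" "\<sigma> n \<in> Theta_h k Th" "c n \<in> Lambda_h k Th" "lc n \<in> Sigma_h k Th"
    using sol n by (auto simp: HMDGFE_solution_def Let_def)
  have prev: "c (n - 1) \<in> Lambda_h k Th"
  proof (cases "n = 1")
    case False
    then have "n - 1 \<in> {1..M}" using n by auto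
    then show ?thesis using sol by (auto simp: HMDGFE_solution_def Let_def)
  qed (use sol in \<open>auto simp: HMDGFE_solution_def Let_def\<close>)
  have zero_flux: "(\<lambda>_ _. 0) \<in> Theta_h k Th"
    unfolding Theta_h_def RT_def
    by (auto intro!: exI[of _ "\<lambda>_. 0"] polys_const)
  have flow: "B_u Th perm visc (c (n - 1)) (u n, p n, l n) (\<lambda>_ _. 0, v, m)
        = - elements_int Th (\<lambda>K x. q x (t n) * v K x)"
    and conc: "B_c Th \<phi> dm dl dt \<Delta>t (u n) (\<sigma> n, c n, lc n) (\<lambda>_ _. 0, v, m)
        = - elements_int Th (\<lambda>K x. (q x (t n) * ext_conc (\<lambda>y. q y (t n)) (\<lambda>y. cstar y (t n)) (c n) K x
              + \<phi> x / \<Delta>t * c (n - 1) K x) * v K x)"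
    if "v \<in> Lambda_h k Th" "m \<in> Sigma_h k Th" for v m
    unfolding tn time(3)
    using sol[unfolded HMDGFE_solution_def Let_def, THEN conjunct2, rule_format, OF n] that zero_flux
    by blast+
  have test_consts: "(\<lambda>K _. a K) \<in> Lambda_h k Th" "(\<lambda>_ _. 0) \<in> Sigma_h k Th" for a
    by (auto simp: Lambda_h_def Sigma_h_def polys_const)
  have facet: "compact e" "convex e" "e \<subseteq> K" "e \<in> mesh_faces Th"
    if "K \<in> Th" "e facet_of K" for e K
    using that Th(2)[OF that(1)] facet_of_imp_subset[OF that(2)]
    by (auto simp: facet_of_def mesh_faces_def
        intro: face_of_imp_convex face_of_imp_compact polytope_imp_convex polytope_imp_compact)
  have trace: "(\<lambda>x. w K x \<bullet> outward_normal K e) \<in> polys k e"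
    if trace_of: "w \<in> Theta_h k Th" "K \<in> Th" "e facet_of K" for w K e
  proof -
    obtain b where "e = K \<inter> {x. outward_normal K e \<bullet> x = b}"
      using outward_normal_exposes[OF Th(2,3)[OF trace_of(2)] trace_of(3)] by blast
    then show ?thesis
      using trace_of facet(3)[OF trace_of(2,3)] by (intro RT_normal_trace[of _ k K]) (auto simp: Theta_h_def)
  qed
  have element: "continuous_on K (v K)" if "v \<in> Lambda_h k Th" "K \<in> Th" for v K
    using that by (intro continuous_on_polys) (auto simp: Lambda_h_def)
  {
    fix K assume K: "K \<in> Th"
    have "skeleton_int Th (\<lambda>L e x. (u n L x \<bullet> outward_normal L e) * (0 - of_bool (L = K)))
        = - elements_int Th (\<lambda>L x. q x (t n) * of_bool (L = K))"
      using flow[OF test_consts(1,2)] unfolding B_u_piecewise_constant_test .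
    then show "boundary_int K (\<lambda>e x. u n K x \<bullet> outward_normal K e) = (LINT x:K|lebesgue. q x (t n))"
      unfolding skeleton_int_single_element[OF Th(1) K] elements_int_single[OF Th(1) K] by simp
  next
    fix e K1 K2 x assume e: "interior_face Th e K1 K2" and x: "x \<in> e"
    have K: "K1 \<in> Th" "K2 \<in> Th" "K1 \<noteq> K2" "e facet_of K1" "e facet_of K2"
      using e by (auto simp: interior_face_def)
    define f where "f = (\<lambda>x. u n K1 x \<bullet> outward_normal K1 e + u n K2 x \<bullet> outward_normal K2 e)"
    have tr: "(\<lambda>x. u n K1 x \<bullet> outward_normal K1 e) \<in> polys k e"
      "(\<lambda>x. u n K2 x \<bullet> outward_normal K2 e) \<in> polys k e"
      using trace spaces(1) K by auto
    then have f: "f \<in> polys k e" unfolding f_def by (rule polys_add)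
    note cont = tr[THEN continuous_on_polys] continuous_on_polys[OF f]
    \<comment> \<open>the jump of the normal flux is itself an admissible multiplier\<close>
    have m: "(\<lambda>e' x. if e' = e then f x else 0) \<in> Sigma_h k Th"
      unfolding Sigma_h_def
    proof safe
      fix e'
      show "(\<lambda>x. if e' = e then f x else 0) \<in> polys k e'"
        using f by (cases "e' = e") (simp_all add: polys_const)
    qed
    have "skeleton_int Th (\<lambda>L e' x. (u n L x \<bullet> outward_normal L e') * ((if e' = e then f x else 0) - 0)) = 0"
      using flow[OF test_consts(1) m, of "\<lambda>_. 0"] unfolding B_u_piecewise_constant_test
      by (simp add: elements_int_def)
    then have "(\<Sum>K\<in>{K1, K2}. LINT x:e|surface_measure e. (u n K x \<bullet> outward_normal K e) * f x) = 0"
      unfolding single_face[OF e] by simp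
    moreover have int: "set_integrable (surface_measure e) e (\<lambda>x. (u n K1 x \<bullet> outward_normal K1 e) * f x)"
      "set_integrable (surface_measure e) e (\<lambda>x. (u n K2 x \<bullet> outward_normal K2 e) * f x)"
      using facet(1)[OF K(1,4)] cont by (auto intro!: set_integrable_surface_continuous continuous_on_mult)
    ultimately have "(LINT x:e|surface_measure e. (u n K1 x \<bullet> outward_normal K1 e) * f x
          + (u n K2 x \<bullet> outward_normal K2 e) * f x) = 0"
      using K(3) by (simp add: set_integral_add(2)[OF int])
    then have "(LINT x:e|surface_measure e. f x * f x) = 0"
      by (simp add: f_def distrib_right)
    then have "f x * f x = 0"
      using facet(1,2)[OF K(1,4)] cont(3) x
      by (intro zero_if_surface_integral_zero[of e "\<lambda>x. f x * f x"]) (auto intro: continuous_on_mult)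
    then show "u n K1 x \<bullet> outward_normal K1 e + u n K2 x \<bullet> outward_normal K2 e = 0"
      by (simp add: f_def)
  next
    fix K assume K: "K \<in> Th"
    let ?F = "\<lambda>e x. \<sigma> n K x \<bullet> outward_normal K e
      + (u n K x \<bullet> outward_normal K e) * upwind (u n) (c n) (lc n) K e x"
    let ?q = "\<lambda>x. q x (t n) * ext_conc (\<lambda>y. q y (t n)) (\<lambda>y. cstar y (t n)) (c n) K x"
    have dom: "open \<Omega>" "negligible (frontier \<Omega>)"
      using domain negligible_frontier_polyhedral_domain by (auto simp: polyhedral_domain_def)
    have Kc: "compact K" "K \<subseteq> closure \<Omega>"
      using Th(2,4)[OF K] by (auto intro: polytope_imp_compact)
    note phi_c = set_integrable_times_continuous[OF dom phi_int Kc]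
    have int: "set_integrable lebesgue K (\<lambda>x. \<phi> x * c n K x)"
      "set_integrable lebesgue K (\<lambda>x. \<phi> x * c (n - 1) K x)" "set_integrable lebesgue K ?q"
      using phi_c[OF element[OF spaces(3) K]] phi_c[OF element[OF prev K]]
        set_integrable_source[OF dom q_int[OF n] qc_int[OF n] Kc, of "c n"] element[OF spaces(3) K]
      by auto
    have "- (1 / \<Delta>t) * elements_int Th (\<lambda>L x. \<phi> x * c n L x * of_bool (L = K))
        + skeleton_int Th (\<lambda>L e x. (\<sigma> n L x \<bullet> outward_normal L e
            + (u n L x \<bullet> outward_normal L e) * upwind (u n) (c n) (lc n) L e x) * (0 - of_bool (L = K)))
        = - elements_int Th (\<lambda>L x. (q x (t n) * ext_conc (\<lambda>y. q y (t n)) (\<lambda>y. cstar y (t n)) (c n) L x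
              + \<phi> x / \<Delta>t * c (n - 1) L x) * of_bool (L = K))"
      using conc[OF test_consts(1,2)] unfolding B_c_piecewise_constant_test .
    then have bal: "(1 / \<Delta>t) * (LINT x:K|lebesgue. \<phi> x * c n K x) + boundary_int K ?F
        = (LINT x:K|lebesgue. ?q x + (1 / \<Delta>t) * (\<phi> x * c (n - 1) K x))"
      unfolding skeleton_int_single_element[OF Th(1) K] elements_int_single[OF Th(1) K] by simp
    have rhs: "(LINT x:K|lebesgue. ?q x + (1 / \<Delta>t) * (\<phi> x * c (n - 1) K x))
        = (LINT x:K|lebesgue. ?q x) + (1 / \<Delta>t) * (LINT x:K|lebesgue. \<phi> x * c (n - 1) K x)"
      using int(2,3) by (subst set_integral_add(2)) (auto simp: set_integral_mult_right)
    have acc: "(LINT x:K|lebesgue. \<phi> x * (c n K x - c (n - 1) K x))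
        = (LINT x:K|lebesgue. \<phi> x * c n K x) - (LINT x:K|lebesgue. \<phi> x * c (n - 1) K x)"
      unfolding right_diff_distrib using int(1,2) by (rule set_integral_diff(2))
    have bnd: "boundary_int K ?F = boundary_int K (\<lambda>e x. \<sigma> n K x \<bullet> outward_normal K e)
        + (\<Sum>e | e facet_of K. LINT x:outflow (u n) K e|surface_measure e.
            (u n K x \<bullet> outward_normal K e) * c n K x)
        + (\<Sum>e | e facet_of K. LINT x:inflow (u n) K e|surface_measure e.
            (u n K x \<bullet> outward_normal K e) * lc n e x)"
      unfolding boundary_int_def sum.distrib[symmetric]
    proof (intro sum.cong refl upwind_flux_split)
      fix e assume "e \<in> {e. e facet_of K}"
      then have e: "e facet_of K" by simp
      show "compact e" by (rule facet(1)[OF K e])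
      show "continuous_on e (\<lambda>x. \<sigma> n K x \<bullet> outward_normal K e)"
        "continuous_on e (\<lambda>x. u n K x \<bullet> outward_normal K e)"
        using trace[OF _ K e] spaces(1,2) by (auto intro: continuous_on_polys)
      show "continuous_on e (c n K)"
        using element[OF spaces(3) K] facet(3)[OF K e] by (rule continuous_on_subset)
      show "continuous_on e (lc n e)"
        using spaces(4) facet(4)[OF K e] by (auto simp: Sigma_h_def intro: continuous_on_polys)
    qed
    show "1 / \<Delta>t * (LINT x:K|lebesgue. \<phi> x * (c n K x - c (n - 1) K x))
       + boundary_int K (\<lambda>e x. \<sigma> n K x \<bullet> outward_normal K e)
       + (\<Sum>e | e facet_of K. LINT x:outflow (u n) K e|surface_measure e.
            (u n K x \<bullet> outward_normal K e) * c n K x)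
       + (\<Sum>e | e facet_of K. LINT x:inflow (u n) K e|surface_measure e.
            (u n K x \<bullet> outward_normal K e) * lc n e x)
       = (LINT x:K|lebesgue. ?q x)"
      using bal unfolding rhs bnd acc right_diff_distrib[of "1 / \<Delta>t"] by linarith
  next
    fix e K1 K2 assume e: "interior_face Th e K1 K2"
    have m: "(\<lambda>e' x. if e' = e then 1 else 0) \<in> Sigma_h k Th"
      by (simp add: Sigma_h_def polys_const)
    have "skeleton_int Th (\<lambda>L e' x. (\<sigma> n L x \<bullet> outward_normal L e'
            + (u n L x \<bullet> outward_normal L e') * upwind (u n) (c n) (lc n) L e' x)
          * ((if e' = e then 1 else 0) - 0)) = 0"
      using conc[OF test_consts(1) m, of "\<lambda>_. 0"] unfolding B_c_piecewise_constant_test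
      by (simp add: elements_int_def)
    then show "(\<Sum>K\<in>{K1, K2}. LINT x:e|surface_measure e.
          \<sigma> n K x \<bullet> outward_normal K e
          + (u n K x \<bullet> outward_normal K e) * upwind (u n) (c n) (lc n) K e x) = 0"
      unfolding single_face[OF e] by simp
  }
qed

end
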